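(* Let $d\ge1$ be an integer and let $f:\mathbb R^d\to\mathbb R$ with $f\in L^1(\mathbb R^d)\cap L^2(\mathbb R^d)$. Assume that for some real $p>d$, $$\int_{\mathbb R^d}|x|^p|f(x)|^2\,dx<\infty .$$ For $L>0$ let $$B_d(L):=\sum_{\mathbf k\in\mathbb N_0^d}\frac1{L^d}\left|\int_{\mathbb R^d\setminus[-L,L]^d} f(x)\prod_{i=1}^d\cos\left(\frac{k_i\pi(x_i+L)}{2L}\right)dx\right|^2 .$$ Then $f$ is $d$-dimensional COS-admissible, i.e. $B_d(L)\to0$ as $L\to\infty$. More precisely, for every $L>0$, $$B_d(L)\le C_{d,p}\,L^{-p}\int_{\mathbb R^d\setminus[-L,L]^d}|x|^p|f(x)|^2\,dx,$$ where $$C_{d,p}=2^{d-1}\left(1+d^{p/2}\right)\sum_{m\in\mathbb Z^d\setminus\{0\}}|m|^{-p}<\infty .$$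
   Context: $|\cdot|$ denotes the Euclidean norm on $\mathbb R^d$ (and on $\mathbb Z^d\subset\mathbb R^d$), $\mathbb N_0=\{0,1,2,\dots\}$, and $\mathbf k=(k_1,\dots,k_d)$. A function $f\in L^1(\mathbb R^d)\cap L^2(\mathbb R^d)$ is called $d$-dimensional COS-admissible if $B_d(L)\to0$ as $L\to\infty$, where for $L>0$ $$B_d(L)=\sum_{\mathbf k\in\mathbb N_0^d}\frac1{L^d}\left|\int_{\mathbb R^d\setminus[-L,L]^d} f(x)\prod_{i=1}^d\cos\left(\frac{k_i\pi(x_i+L)}{2L}\right)dx\right|^2 ,$$ a quantity a priori in $[0,\infty]$. *)

theory Defs
  imports "HOL-Analysis.Analysis"
begin

definition L1_L2 :: "(real ^ 'd \<Rightarrow> real) \<Rightarrow> bool" where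
  "L1_L2 f \<longleftrightarrow> integrable lebesgue f \<and> integrable lebesgue (\<lambda>x. (f x)\<^sup>2)"

definition outer_region :: "real \<Rightarrow> (real ^ 'd) set" where
  "outer_region L = UNIV - cbox (\<chi> i. - L) (\<chi> i. L)"

text \<open>The series is taken in \<^typ>\<open>ennreal\<close>, where every sum of nonnegative terms
  exists, so divergence shows up as the value \<open>\<infinity>\<close> and not as the default value \<open>0\<close>
  of a non-summable real family.\<close>

definition cos_B :: "(real ^ 'd \<Rightarrow> real) \<Rightarrow> real \<Rightarrow> ennreal" where
  "cos_B f L = (\<Sum>\<^sub>\<infinity>k\<in>(UNIV :: (nat ^ 'd) set).
     ennreal (1 / L ^ CARD('d) *
       \<bar>LINT x:outer_region L|lebesgue.
          f x * (\<Prod>i\<in>UNIV. cos (real (k $ i) * pi * (x $ i + L) / (2 * L)))\<bar>\<^sup>2))"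

definition cos_admissible :: "(real ^ 'd \<Rightarrow> real) \<Rightarrow> bool" where
  "cos_admissible f \<longleftrightarrow> L1_L2 f \<and> (cos_B f \<longlongrightarrow> 0) at_top"

text \<open>There is no norm on \<^typ>\<open>int ^ 'd\<close>, so lattice points are embedded into
  \<^typ>\<open>real ^ 'd\<close> first.\<close>

definition cos_C :: "'d::finite itself \<Rightarrow> real \<Rightarrow> ennreal" where
  "cos_C _ p = ennreal (2 ^ (CARD('d) - 1) * (1 + real CARD('d) powr (p / 2))) *
     (\<Sum>\<^sub>\<infinity>m\<in>(UNIV - {0} :: (int ^ 'd) set).
        ennreal (norm (\<chi> i. real_of_int (m $ i)) powr (- p)))"

end

theory Submission
  imports Defs
begin

text \<open>Tile the space by the cubes \<open>2 L m + [-L, L]\<^sup>d\<close> with \<open>m\<close> in the integer lattice. The cosine products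
  are orthogonal on every cube, with squared norm at most \<open>(2 L)\<^sup>d\<close>, and \<open>|x| \<ge> L |m|\<close> on cube \<open>m\<close>.
  Hence a cosine polynomial \<open>P\<close> with coefficients \<open>a\<close> has \<open>|x| powr (- p)\<close>-weighted squared norm over the
  outer region at most \<open>S L powr (- p) (2 L)\<^sup>d \<Sum> a\<^sub>k\<^sup>2\<close>, where \<open>S\<close> is the lattice sum. By duality
  this yields the estimate with constant \<open>2\<^sup>d S\<close>, and \<open>2\<^sup>d \<le> 2\<^sup>d\<^sup>-\<^sup>1 (1 + d powr (p / 2))\<close>.\<close>

section \<open>Cosine products on the cells of a cubic tiling\<close>

text \<open>By \<open>lborel_eq\<close>, \<open>lborel\<close> on vectors is the image of the
  product measure indexed by \<open>Basis\<close>. Since \<open>axis\<close> puts the coordinates in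
  bijection with \<open>Basis\<close>, Fubini for finite product measures yields both
  claims.\<close>

lemma integral_lborel_prod_vec:
  fixes g :: "'d::finite \<Rightarrow> real \<Rightarrow> real"
  assumes "\<And>i. integrable lborel (g i)"
  shows "integrable lborel (\<lambda>x::real^'d. \<Prod>i\<in>UNIV. g i (x $ i))"
    and "integral\<^sup>L lborel (\<lambda>x::real^'d. \<Prod>i\<in>UNIV. g i (x $ i)) = (\<Prod>i\<in>UNIV. integral\<^sup>L lborel (g i))"
proof -
  interpret product_sigma_finite "\<lambda>_::real^'d. lborel :: real measure"
    by (rule product_sigma_finite.intro) (rule sigma_finite_lborel)
  \<comment> \<open>\<open>ix\<close> inverts \<open>axis\<close> on \<open>Basis\<close>, so that
    products over coordinates can be rewritten as products over basis vectors.\<close>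
  define ix :: "real^'d \<Rightarrow> 'd" where "ix b = (THE i. b = axis i 1)" for b
  have ix [simp]: "ix (axis i 1) = i" for i
    by (auto simp: ix_def axis_eq_axis)
  have Basis_eq: "Basis = range (\<lambda>i::'d. axis i (1::real))"
    by (auto simp: Basis_vec_def)
  have inj: "inj (\<lambda>i::'d. axis i (1::real))"
    by (auto simp: inj_on_def axis_eq_axis)
  have reindex: "(\<Prod>i\<in>UNIV. h i) = (\<Prod>b\<in>Basis. h (ix b))" for h :: "'d \<Rightarrow> real"
    unfolding Basis_eq by (subst prod.reindex[OF inj]) simp
  have meas [measurable]: "g i \<in> borel_measurable borel" for i
    using borel_measurable_integrable[OF assms[of i]] by simp
  have comp: "(\<Sum>b\<in>Basis. y b *\<^sub>R b) $ ix b = y b" if "b \<in> Basis" for y and b :: "real^'d"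
  proof -
    from that obtain i where i: "b = axis i 1" unfolding Basis_eq by blast
    have "(\<Sum>b\<in>Basis. y b *\<^sub>R b) $ i = (\<Sum>b\<in>Basis. y b *\<^sub>R b) \<bullet> b"
      by (simp add: i cart_eq_inner_axis)
    also have "\<dots> = y b" using that by (rule inner_sum_left_Basis)
    finally show ?thesis by (simp add: i)
  qed
  have eq: "(\<Prod>i\<in>UNIV. g i ((\<Sum>b\<in>Basis. y b *\<^sub>R b) $ i)) = (\<Prod>b\<in>Basis. g (ix b) (y b))"
    for y :: "real^'d \<Rightarrow> real"
    by (subst reindex) (intro prod.cong refl, simp only: comp)
  have sm: "(\<lambda>y. \<Sum>b\<in>Basis. y b *\<^sub>R b) \<in> (\<Pi>\<^sub>M b\<in>(Basis::(real^'d) set). lborel) \<rightarrow>\<^sub>M borel"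
    by measurable
  have pm: "(\<lambda>x::real^'d. \<Prod>i\<in>UNIV. g i (x $ i)) \<in> borel_measurable borel"
    by measurable
  show "integrable lborel (\<lambda>x::real^'d. \<Prod>i\<in>UNIV. g i (x $ i))"
    by (subst lborel_eq, subst integrable_distr_eq[OF sm pm])
       (simp only: eq, intro product_integrable_prod finite_Basis assms)
  show "integral\<^sup>L lborel (\<lambda>x::real^'d. \<Prod>i\<in>UNIV. g i (x $ i)) = (\<Prod>i\<in>UNIV. integral\<^sup>L lborel (g i))"
    by (subst lborel_eq, subst integral_distr[OF sm pm])
       (simp only: eq reindex, intro product_integral_prod finite_Basis assms)
qed

section \<open>Orthogonality of the cosine system on one cell\<close>

text \<open>The cube of side \<open>2 * L\<close> centred at \<open>2 * L\<close> times
  \<open>m\<close>; \<open>m = 0\<close> gives the cube removed in \<open>outer_region L\<close>.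
  The cells are closed and share faces, which is harmless: the later argument only uses that they
  cover the space, and overlaps merely enlarge an upper bound.\<close>

definition cell :: "real \<Rightarrow> int ^ 'd \<Rightarrow> (real ^ 'd) set" where
  "cell L m = cbox (\<chi> i. (2 * real_of_int (m $ i) - 1) * L) (\<chi> i. (2 * real_of_int (m $ i) + 1) * L)"

text \<open>These are, up to normalisation, the Neumann eigenfunctions of \<open>cell L 0\<close>.
  They are even under reflection in the faces of the cells, hence behave alike on all cells.\<close>

definition cos_prod :: "real \<Rightarrow> nat ^ 'd \<Rightarrow> real ^ 'd \<Rightarrow> real" where
  "cos_prod L k x = (\<Prod>i\<in>UNIV. cos (real (k $ i) * pi * (x $ i + L) / (2 * L)))"

text \<open>At both endpoints \<open>x + L\<close> is an integer multiple of \<open>2 * L\<close>,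
  so the sine in the antiderivative is evaluated at multiples of \<open>pi\<close>. The frequency is
  an integer because differences of natural frequencies are inserted later.\<close>

lemma cos_integral_cell:
  fixes n m :: int and L :: real
  assumes L: "L > 0"
  shows "has_bochner_integral lborel
    (\<lambda>x. cos (of_int n * pi * (x + L) / (2 * L)) * indicator {(2 * of_int m - 1) * L..(2 * of_int m + 1) * L} x)
    (if n = 0 then 2 * L else 0)"
proof -
  \<comment> \<open>For \<open>n = 0\<close> the sine formula would divide by zero, and the
    integrand is the constant 1, whence the separate branch.\<close>
  define F where "F x = (if n = 0 then x else
    sin (of_int n * pi * (x + L) / (2 * L)) * (2 * L) / (of_int n * pi))" for x
  have "(F has_real_derivative cos (of_int n * pi * (x + L) / (2 * L))) (at x)" for x
  proof (cases "n = 0")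
    case True
    then show ?thesis by (simp add: F_def[abs_def])
  next
    case False
    then have "F = (\<lambda>x. sin (of_int n * pi * (x + L) / (2 * L)) * (2 * L) / (of_int n * pi))"
      by (auto simp: F_def)
    moreover have "(\<dots> has_real_derivative cos (of_int n * pi * (x + L) / (2 * L))) (at x)"
      using L False by (auto intro!: derivative_eq_intros)
    ultimately show ?thesis by simp
  qed
  then have *: "has_bochner_integral lborel
    (\<lambda>x. cos (of_int n * pi * (x + L) / (2 * L)) * indicator {(2 * of_int m - 1) * L..(2 * of_int m + 1) * L} x)
    (F ((2 * of_int m + 1) * L) - F ((2 * of_int m - 1) * L))"
    using L by (intro has_bochner_integral_FTC_Icc_real) (auto intro!: mult_right_mono continuous_intros)
  have sin_zero: "sin (of_int j * pi) = 0" for j :: int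
    by (auto simp: sin_zero_iff_int2)
  have "sin (of_int n * pi * ((2 * of_int m + 1) * L + L) / (2 * L)) = sin (of_int (n * (m + 1)) * pi)"
    using L by (intro arg_cong[where f = sin]) (simp add: field_simps)
  moreover have "sin (of_int n * pi * ((2 * of_int m - 1) * L + L) / (2 * L)) = sin (of_int (n * m) * pi)"
    using L by (intro arg_cong[where f = sin]) (simp add: field_simps)
  ultimately have "F ((2 * of_int m + 1) * L) - F ((2 * of_int m - 1) * L) = (if n = 0 then 2 * L else 0)"
    unfolding F_def using sin_zero by (simp del: of_int_mult of_int_add) (simp add: algebra_simps)
  with * show ?thesis by simp
qed

text \<open>The product-to-sum formula reduces this to the frequencies \<open>k - l\<close> and
  \<open>k + l\<close>. The second one vanishes only for \<open>k = l = 0\<close>, which is why the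
  constant mode has twice the squared norm of the others.\<close>

lemma cos_orthogonal_cell:
  fixes k l :: nat and m :: int and L :: real
  assumes L: "L > 0"
  shows "has_bochner_integral lborel
    (\<lambda>x. cos (real k * pi * (x + L) / (2 * L)) * cos (real l * pi * (x + L) / (2 * L)) *
      indicator {(2 * of_int m - 1) * L..(2 * of_int m + 1) * L} x)
    (if k = l then (if k = 0 then 2 * L else L) else 0)"
proof -
  let ?I = "indicator {(2 * of_int m - 1) * L..(2 * of_int m + 1) * L} :: real \<Rightarrow> real"
  let ?c = "\<lambda>n x. cos (of_int n * pi * (x + L) / (2 * L))"
  have "has_bochner_integral lborel (\<lambda>x. (?c (int k - int l) x * ?I x + ?c (int k + int l) x * ?I x) / 2)
      (((if int k - int l = 0 then 2 * L else 0) + (if int k + int l = 0 then 2 * L else 0)) / 2)"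
    by (intro has_bochner_integral_divide_zero has_bochner_integral_add cos_integral_cell L)
  moreover have "(?c (int k - int l) x * ?I x + ?c (int k + int l) x * ?I x) / 2 =
      ?c (int k) x * ?c (int l) x * ?I x" for x
  proof -
    have "?c (int k) x * ?c (int l) x = (?c (int k - int l) x + ?c (int k + int l) x) / 2"
      unfolding cos_times_cos
      by (simp only: of_int_diff of_int_add left_diff_distrib distrib_right diff_divide_distrib add_divide_distrib)
    then show ?thesis by (simp only: distrib_right add_divide_distrib times_divide_eq_left)
  qed
  moreover have "((if int k - int l = 0 then 2 * L else 0) + (if int k + int l = 0 then 2 * L else 0)) / 2
      = (if k = l then (if k = 0 then 2 * L else L) else 0)"
    by auto
  ultimately show ?thesis by simp
qed

text \<open>The indicator of a cell is a product of interval indicators, so the integrals factor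
  over the coordinates. One coordinate with different frequencies kills the product; on the diagonal
  every factor is \<open>L\<close> or \<open>2 * L\<close>.\<close>

lemma cos_prod_orthogonal_cell:
  fixes k l :: "nat ^ 'd" and m :: "int ^ 'd"
  assumes L: "L > 0"
  shows "integrable lborel (\<lambda>x. cos_prod L k x * cos_prod L l x * indicator (cell L m) x)"
    and "k \<noteq> l \<Longrightarrow> (LINT x|lborel. cos_prod L k x * cos_prod L l x * indicator (cell L m) x) = 0"
    and "(LINT x|lborel. cos_prod L k x * cos_prod L k x * indicator (cell L m) x) \<le> (2 * L) ^ CARD('d)"
proof -
  define g where "g k l i x = cos (real (k $ i) * pi * (x + L) / (2 * L)) * cos (real (l $ i) * pi * (x + L) / (2 * L)) *
      indicator {(2 * of_int (m $ i) - 1) * L..(2 * of_int (m $ i) + 1) * L} x"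
      for k l :: "nat ^ 'd" and i x
  have g: "has_bochner_integral lborel (g k l i) (if k $ i = l $ i then (if k $ i = 0 then 2 * L else L) else 0)"
    for k l i unfolding g_def by (rule cos_orthogonal_cell[OF L])
  have ind: "indicator (cell L m) x = (\<Prod>i\<in>UNIV.
      indicator {(2 * of_int (m $ i) - 1) * L..(2 * of_int (m $ i) + 1) * L} (x $ i) :: real)" for x
    by (auto simp: cell_def mem_box_cart indicator_def prod_zero_iff)
  have eq: "cos_prod L k x * cos_prod L l x * indicator (cell L m) x = (\<Prod>i\<in>UNIV. g k l i (x $ i))" for k l x
    by (simp add: cos_prod_def g_def prod.distrib ind)
  have int: "integrable lborel (g k l i)" for k l i
    using g has_bochner_integral_iff by blast
  show "integrable lborel (\<lambda>x. cos_prod L k x * cos_prod L l x * indicator (cell L m) x)"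
    unfolding eq by (rule integral_lborel_prod_vec(1)[OF int])
  have val: "(LINT x|lborel. cos_prod L k x * cos_prod L l x * indicator (cell L m) x) =
      (\<Prod>i\<in>UNIV. if k $ i = l $ i then (if k $ i = 0 then 2 * L else L) else 0)" for k l
    unfolding eq integral_lborel_prod_vec(2)[OF int]
    by (intro prod.cong refl has_bochner_integral_integral_eq g)
  show "(LINT x|lborel. cos_prod L k x * cos_prod L l x * indicator (cell L m) x) = 0" if "k \<noteq> l"
  proof -
    from that obtain i where "k $ i \<noteq> l $ i" by (auto simp: vec_eq_iff)
    then show ?thesis unfolding val by (intro prod_zero bexI[of _ i]) auto
  qed
  show "(LINT x|lborel. cos_prod L k x * cos_prod L k x * indicator (cell L m) x) \<le> (2 * L) ^ CARD('d)"
    unfolding val using L prod_mono[of UNIV "\<lambda>i. if k $ i = 0 then 2 * L else L" "\<lambda>_. 2 * L"] by auto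
qed

lemma continuous_cos_prod: "continuous_on UNIV (cos_prod L k)"
  unfolding cos_prod_def divide_inverse by (intro continuous_intros)

lemma borel_measurable_cos_prod [measurable]: "cos_prod L k \<in> borel_measurable borel"
  using continuous_cos_prod by (rule borel_measurable_continuous_onI)

lemma abs_cos_prod_le: "\<bar>cos_prod L k x\<bar> \<le> 1"
  unfolding cos_prod_def abs_prod by (rule prod_le_1) simp

text \<open>Expand the square; orthogonality leaves only the diagonal terms. The bound does not
  depend on \<open>m\<close>, so it can later be pulled out of the sum over cells.\<close>

lemma nn_integral_cos_polynomial_cell:
  fixes a :: "nat ^ 'd \<Rightarrow> real" and m :: "int ^ 'd"
  assumes L: "L > 0" and K: "finite K"
  shows "(\<integral>\<^sup>+x. ennreal ((\<Sum>k\<in>K. a k * cos_prod L k x)\<^sup>2) * indicator (cell L m) x \<partial>lborel)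
    \<le> ennreal ((2 * L) ^ CARD('d) * (\<Sum>k\<in>K. (a k)\<^sup>2))"
proof -
  let ?P = "\<lambda>x. \<Sum>k\<in>K. a k * cos_prod L k x"
  let ?c = "\<lambda>k l x. cos_prod L k x * cos_prod L l x * indicator (cell L m) x"
  note orth = cos_prod_orthogonal_cell[OF L]
  have exp: "(?P x)\<^sup>2 * indicator (cell L m) x = (\<Sum>k\<in>K. \<Sum>l\<in>K. a k * a l * ?c k l x)" for x
    by (simp only: power2_eq_square sum_product) (simp add: sum_distrib_left sum_distrib_right mult_ac)
  have int: "integrable lborel (\<lambda>x. (?P x)\<^sup>2 * indicator (cell L m) x)"
    unfolding exp by (intro Bochner_Integration.integrable_sum integrable_mult_right orth(1))
  have "(LINT x|lborel. (?P x)\<^sup>2 * indicator (cell L m) x) = (\<Sum>k\<in>K. \<Sum>l\<in>K. a k * a l * (LINT x|lborel. ?c k l x))"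
    unfolding exp by (simp add: Bochner_Integration.integral_sum Bochner_Integration.integrable_sum orth(1))
  also have "\<dots> = (\<Sum>k\<in>K. \<Sum>l\<in>K. if k = l then (a k)\<^sup>2 * (LINT x|lborel. ?c k k x) else 0)"
    by (intro sum.cong refl) (auto simp: orth(2) power2_eq_square)
  also have "\<dots> = (\<Sum>k\<in>K. (a k)\<^sup>2 * (LINT x|lborel. ?c k k x))"
    using K by simp
  also have "\<dots> \<le> (\<Sum>k\<in>K. (a k)\<^sup>2 * (2 * L) ^ CARD('d))"
    by (intro sum_mono mult_left_mono orth(3)) simp
  finally have le: "(LINT x|lborel. (?P x)\<^sup>2 * indicator (cell L m) x) \<le> (2 * L) ^ CARD('d) * (\<Sum>k\<in>K. (a k)\<^sup>2)"
    by (simp add: sum_distrib_left mult_ac)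
  have "(\<integral>\<^sup>+x. ennreal ((?P x)\<^sup>2) * indicator (cell L m) x \<partial>lborel) =
      (\<integral>\<^sup>+x. ennreal ((?P x)\<^sup>2 * indicator (cell L m) x) \<partial>lborel)"
    by (intro nn_integral_cong) (auto simp: indicator_def)
  also have "\<dots> = ennreal (LINT x|lborel. (?P x)\<^sup>2 * indicator (cell L m) x)"
    by (rule nn_integral_eq_integral[OF int]) simp
  finally show ?thesis using le by (simp add: ennreal_leI)
qed

section \<open>Lattice sums\<close>

lemma infsum_ennreal_eq_SUP:
  fixes f :: "'a \<Rightarrow> ennreal"
  shows "infsum f A = (SUP F\<in>{F. finite F \<and> F \<subseteq> A}. sum f F)"
  by (rule nonneg_infsum_complete) simp

text \<open>Leads from counting-measure integrals, for which Tonelli is available, to the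
  \<open>infsum\<close> in \<open>cos_C\<close>. Along an enumeration of an infinite
  \<open>A\<close>, every partial sum is a sum over a finite subset.\<close>

lemma nn_integral_count_space_le_infsum:
  fixes f :: "'a \<Rightarrow> ennreal"
  assumes "countable A"
  shows "(\<integral>\<^sup>+x. f x \<partial>count_space A) \<le> infsum f A"
proof (cases "finite A")
  case True
  then show ?thesis by (simp add: nn_integral_count_space_finite)
next
  case False
  let ?g = "from_nat_into A"
  have g: "bij_betw ?g UNIV A" by (rule bij_betw_from_nat_into[OF assms False])
  have "(\<integral>\<^sup>+x. f x \<partial>count_space A) = (\<integral>\<^sup>+n. f (?g n) \<partial>count_space UNIV)"
    by (rule nn_integral_bij_count_space[OF g, symmetric])
  also have "\<dots> = (\<Sum>n. f (?g n))" by (rule nn_integral_count_space_nat)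
  also have "\<dots> = (SUP n. \<Sum>i<n. f (?g i))" by (rule suminf_eq_SUP)
  also have "\<dots> \<le> infsum f A"
  proof (rule SUP_least)
    fix n
    have inj: "inj_on ?g {..<n}" using g by (auto simp: bij_betw_def inj_on_def)
    have "(\<Sum>i<n. f (?g i)) = sum f (?g ` {..<n})"
      by (simp add: sum.reindex[OF inj])
    also have "\<dots> \<le> infsum f A"
      unfolding infsum_ennreal_eq_SUP using g by (intro SUP_upper) (auto simp: bij_betw_def)
    finally show "(\<Sum>i<n. f (?g i)) \<le> infsum f A" .
  qed
  finally show ?thesis .
qed

lemma norm_of_int_vec_ge_1:
  fixes m :: "int ^ 'd"
  assumes "m \<noteq> 0"
  shows "norm (\<chi> i. real_of_int (m $ i)) \<ge> 1"
proof -
  obtain i where "m $ i \<noteq> 0" using assms by (auto simp: vec_eq_iff)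
  then have "1 \<le> \<bar>real_of_int (m $ i)\<bar>" by linarith
  also have "\<dots> \<le> norm (\<chi> i. real_of_int (m $ i))"
    using component_le_norm_cart[of "\<chi> i. real_of_int (m $ i)" i] by simp
  finally show ?thesis .
qed

text \<open>Since \<open>|m| \<ge> max 1 |m\<^sub>i|\<close> for every \<open>i\<close>, the summand is at most
  \<open>\<Prod>\<^sub>i max 1 |m\<^sub>i| powr (- p / d)\<close>, and the sum of this product factors into one-dimensional sums.\<close>

lemma lattice_sum_finite:
  assumes p: "p > real CARD('d::finite)"
  shows "(\<Sum>\<^sub>\<infinity>m\<in>(UNIV - {0} :: (int ^ 'd) set).
    ennreal (norm (\<chi> i. real_of_int (m $ i)) powr (- p))) < \<infinity>"
proof -
  \<comment> \<open>The exponent is shared equally among the coordinates, and \<open>p > d\<close>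
    becomes \<open>s > 1\<close>, the condition for convergence in one dimension.\<close>
  define s where "s = p / real CARD('d)"
  have d: "real CARD('d) > 0" by simp
  have s: "s > 1" "s * real CARD('d) = p" using p d by (auto simp: s_def)
  \<comment> \<open>Without \<open>max 1\<close> the factor of a vanishing coordinate would be
    \<open>0 powr (- s) = 0\<close>, and the product could not dominate the summand.\<close>
  define h :: "int \<Rightarrow> real" where "h n = max 1 \<bar>of_int n\<bar> powr (- s)" for n
  have h0: "h n \<ge> 0" for n by (simp add: h_def)
  have "summable (\<lambda>n. real n powr (- s))" using s by (simp add: summable_real_powr_iff)
  then have sm: "summable (\<lambda>n. h (int n))"
    by (rule summable_cong[THEN iffD1, rotated])
       (auto simp: h_def max_def intro!: eventually_mono[OF eventually_ge_at_top[of 1]])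
  \<comment> \<open>The factor 2 accounts for both signs; the term at 0 is counted twice.\<close>
  define B where "B = 2 * (\<Sum>n. h (int n))"
  have hB: "sum h {- int N..int N} \<le> B" for N
  proof -
    have "sum h {- int N..int N} \<le> sum h (int ` {..N} \<union> (\<lambda>n. - int n) ` {..N})"
    proof (rule sum_mono2)
      show "{- int N..int N} \<subseteq> int ` {..N} \<union> (\<lambda>n. - int n) ` {..N}"
      proof
        fix x assume "x \<in> {- int N..int N}"
        then have "x = int (nat \<bar>x\<bar>) \<and> nat \<bar>x\<bar> \<le> N \<or> x = - int (nat \<bar>x\<bar>) \<and> nat \<bar>x\<bar> \<le> N" by auto
        then show "x \<in> int ` {..N} \<union> (\<lambda>n. - int n) ` {..N}" by blast
      qed
    qed (auto simp: h0)
    also have "\<dots> \<le> sum h (int ` {..N}) + sum h ((\<lambda>n. - int n) ` {..N})"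
      by (subst sum.union_inter[symmetric]) (auto intro!: sum_nonneg h0)
    also have "\<dots> = 2 * (\<Sum>n\<le>N. h (int n))"
      by (subst (1 2) sum.reindex) (auto simp: inj_on_def h_def)
    also have "\<dots> \<le> B"
      unfolding B_def by (intro mult_left_mono sum_le_suminf sm) (auto simp: h0)
    finally show ?thesis .
  qed
  have summand_le: "norm (\<chi> i. real_of_int (m $ i)) powr (- p) \<le> (\<Prod>i\<in>UNIV. h (m $ i))"
    if "m \<noteq> 0" for m :: "int ^ 'd"
  proof -
    let ?v = "\<chi> i. real_of_int (m $ i) :: real ^ 'd"
    have 1: "norm ?v \<ge> 1" by (rule norm_of_int_vec_ge_1[OF that])
    have le: "norm ?v powr (- s) \<le> h (m $ i)" for i
      unfolding h_def using 1 component_le_norm_cart[of ?v i] s by (intro powr_mono2') auto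
    have "norm ?v powr (- p) = (\<Prod>i\<in>(UNIV::'d set). norm ?v powr (- s))"
      using s(2) 1 by (subst prod_constant, subst powr_power) (auto simp: mult.commute)
    also have "\<dots> \<le> (\<Prod>i\<in>UNIV. h (m $ i))"
      by (intro prod_mono) (auto simp: le)
    finally show ?thesis .
  qed
  have "(\<Sum>m\<in>F. ennreal (norm (\<chi> i. real_of_int (m $ i)) powr (- p))) \<le> ennreal (B ^ CARD('d))"
    if F: "finite F" "F \<subseteq> UNIV - {0}" for F :: "(int ^ 'd) set"
  proof -
    \<comment> \<open>A crude bound for all coordinates of all points of \<open>F\<close>, which
      places \<open>F\<close> in a finite cube of lattice points.\<close>
    define N where "N = (\<Sum>m\<in>F. \<Sum>i\<in>UNIV. nat \<bar>m $ i\<bar>)"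
    have N: "nat \<bar>m $ i\<bar> \<le> N" if "m \<in> F" for m i
    proof -
      have "nat \<bar>m $ i\<bar> \<le> (\<Sum>i\<in>UNIV. nat \<bar>m $ i\<bar>)" by (intro member_le_sum) auto
      also have "\<dots> \<le> N" unfolding N_def using that F by (intro member_le_sum) auto
      finally show ?thesis .
    qed
    \<comment> \<open>Lattice vectors are turned into functions so that \<open>prod_sum_PiE\<close>
      can factor the sum over the cube.\<close>
    have inj: "inj_on (\<lambda>m i. m $ i) F" by (auto simp: inj_on_def vec_eq_iff fun_eq_iff)
    have "(\<Sum>m\<in>F. norm (\<chi> i. real_of_int (m $ i)) powr (- p)) \<le> (\<Sum>m\<in>F. \<Prod>i\<in>UNIV. h (m $ i))"
      using F by (intro sum_mono summand_le) auto
    also have "\<dots> = (\<Sum>g\<in>(\<lambda>m i. m $ i) ` F. \<Prod>i\<in>UNIV. h (g i))"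
      by (simp add: sum.reindex[OF inj])
    also have "\<dots> \<le> (\<Sum>g\<in>PiE (UNIV::'d set) (\<lambda>_. {- int N..int N}). \<Prod>i\<in>UNIV. h (g i))"
    proof (rule sum_mono2)
      show "(\<lambda>m i. m $ i) ` F \<subseteq> PiE UNIV (\<lambda>_. {- int N..int N})"
      proof (clarsimp simp: PiE_def Pi_def)
        fix m i assume "m \<in> F"
        from N[OF this, of i] show "- int N \<le> m $ i \<and> m $ i \<le> int N" by linarith
      qed
    qed (auto intro!: prod_nonneg h0 finite_PiE)
    also have "\<dots> = (\<Prod>i\<in>(UNIV::'d set). sum h {- int N..int N})"
      by (subst prod_sum_PiE) auto
    also have "\<dots> \<le> B ^ CARD('d)"
      by (simp add: power_mono hB sum_nonneg h0)
    finally show ?thesis by (simp add: sum_ennreal ennreal_leI)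
  qed
  then have "(\<Sum>\<^sub>\<infinity>m\<in>(UNIV - {0} :: (int ^ 'd) set). ennreal (norm (\<chi> i. real_of_int (m $ i)) powr (- p)))
      \<le> ennreal (B ^ CARD('d))"
    unfolding infsum_ennreal_eq_SUP by (intro SUP_least) auto
  then show ?thesis by (auto simp: less_top[symmetric] top_unique)
qed


section \<open>The Bessel inequality on the outer region\<close>

text \<open>Round each coordinate of \<open>x\<close> divided by \<open>2 * L\<close> to a nearest
  integer. If all results were 0, then \<open>x\<close> would lie in the removed cube.\<close>

lemma exists_cell:
  fixes x :: "real ^ 'd"
  assumes L: "L > 0" and x: "x \<in> outer_region L"
  obtains m where "m \<noteq> 0" "x \<in> cell L m"
proof -
  define m :: "int ^ 'd" where "m = (\<chi> i. \<lfloor>(x $ i + L) / (2 * L)\<rfloor>)"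
  have m: "(2 * real_of_int (m $ i) - 1) * L \<le> x $ i \<and> x $ i \<le> (2 * real_of_int (m $ i) + 1) * L" for i
  proof -
    have "real_of_int (m $ i) \<le> (x $ i + L) / (2 * L)" "(x $ i + L) / (2 * L) \<le> real_of_int (m $ i) + 1"
      unfolding m_def by (simp_all only: vec_lambda_beta) linarith+
    then show ?thesis using L by (simp add: field_simps)
  qed
  then have "x \<in> cell L m" by (simp add: cell_def mem_box_cart)
  moreover have "m \<noteq> 0"
  proof
    assume "m = 0"
    then have "- L \<le> x $ i \<and> x $ i \<le> L" for i using m[of i] by simp
    with x show False by (auto simp: outer_region_def mem_box_cart)
  qed
  ultimately show ?thesis using that by blast
qed

text \<open>Coordinatewise, a nonzero \<open>m $ i\<close> forces the modulus of
  \<open>x $ i\<close> to be at least \<open>(2 * \<bar>m $ i\<bar> - 1) * L\<close>, and this is at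
  least \<open>\<bar>m $ i\<bar> * L\<close>.\<close>

lemma norm_ge_on_cell:
  assumes L: "L > 0" and x: "x \<in> cell L m"
  shows "L * norm (\<chi> i. real_of_int (m $ i)) \<le> norm x"
proof -
  have "\<bar>(L *\<^sub>R (\<chi> i. real_of_int (m $ i))) $ i\<bar> \<le> \<bar>x $ i\<bar>" for i
  proof -
    have x: "(2 * real_of_int (m $ i) - 1) * L \<le> x $ i" "x $ i \<le> (2 * real_of_int (m $ i) + 1) * L"
      using x by (auto simp: cell_def mem_box_cart)
    consider "m $ i = 0" | "m $ i \<ge> 1" | "m $ i \<le> -1" by linarith
    then show ?thesis
    proof cases
      case 2
      then have "L * real_of_int (m $ i) \<le> (2 * real_of_int (m $ i) - 1) * L"
        using L by (simp add: mult.commute)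
      moreover have "\<bar>L * real_of_int (m $ i)\<bar> = L * real_of_int (m $ i)"
        using 2 L by (simp add: abs_mult)
      ultimately show ?thesis using x by simp
    next
      case 3
      then have "(2 * real_of_int (m $ i) + 1) * L \<le> real_of_int (m $ i) * L"
        using L by (intro mult_right_mono) auto
      then have "x $ i \<le> - (L * - real_of_int (m $ i))" using x by (simp add: mult.commute)
      moreover have "\<bar>L * real_of_int (m $ i)\<bar> = L * - real_of_int (m $ i)"
        using 3 L by (simp add: abs_mult)
      ultimately show ?thesis by simp
    qed auto
  qed
  then have "norm (L *\<^sub>R (\<chi> i. real_of_int (m $ i))) \<le> norm x"
    by (intro norm_le_componentwise_cart) (simp add: norm_real)
  with L show ?thesis by simp
qed

lemma outer_region_borel [measurable]: "outer_region L \<in> sets borel"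
  by (simp add: outer_region_def)

lemma nonzero_on_outer_region: "L > 0 \<Longrightarrow> x \<in> outer_region L \<Longrightarrow> x \<noteq> 0"
  by (auto simp: outer_region_def mem_box_cart)

text \<open>On a cell with \<open>m\<close> nonzero the weight is at most its value at radius
  \<open>L\<close> times the norm of \<open>m\<close>. Dominating the integrand by the sum over
  these cells, applying Tonelli and inserting the uniform cell bound makes the lattice sum appear as
  a factor.\<close>

lemma nn_integral_cos_polynomial_outer:
  fixes a :: "nat ^ 'd \<Rightarrow> real"
  assumes L: "L > 0" and p: "p > 0" and K: "finite K"
  shows "(\<integral>\<^sup>+x\<in>outer_region L. ennreal (norm x powr (- p) * (\<Sum>k\<in>K. a k * cos_prod L k x)\<^sup>2) \<partial>lborel)
    \<le> (\<Sum>\<^sub>\<infinity>m\<in>(UNIV - {0} :: (int ^ 'd) set). ennreal (norm (\<chi> i. real_of_int (m $ i)) powr (- p))) *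
      ennreal (L powr (- p) * ((2 * L) ^ CARD('d) * (\<Sum>k\<in>K. (a k)\<^sup>2)))"
proof -
  let ?P = "\<lambda>x. \<Sum>k\<in>K. a k * cos_prod L k x"
  let ?N = "\<lambda>m::int^'d. norm (\<chi> i. real_of_int (m $ i))"
  let ?Z = "UNIV - {0} :: (int ^ 'd) set"
  have cnt: "countable ?Z" by simp
  have [measurable]: "cell L m \<in> sets borel" for m by (simp add: cell_def)
  have pointwise: "ennreal (norm x powr (- p) * (?P x)\<^sup>2) * indicator (outer_region L) x \<le>
    (\<integral>\<^sup>+m. ennreal (?N m powr (- p) * L powr (- p)) * (ennreal ((?P x)\<^sup>2) * indicator (cell L m) x) \<partial>count_space ?Z)"
    for x
  proof (cases "x \<in> outer_region L")
    case True
    obtain m where m: "m \<noteq> 0" "x \<in> cell L m" by (rule exists_cell[OF L True])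
    have "norm x powr (- p) \<le> (L * ?N m) powr (- p)"
      using norm_ge_on_cell[OF L m(2)] norm_of_int_vec_ge_1[OF m(1)] L p
      by (intro powr_mono2') (auto intro!: mult_pos_pos)
    also have "\<dots> = ?N m powr (- p) * L powr (- p)"
      using L by (simp add: powr_mult mult.commute)
    finally have "norm x powr (- p) * (?P x)\<^sup>2 \<le> (?N m powr (- p) * L powr (- p)) * (?P x)\<^sup>2"
      by (rule mult_right_mono) simp
    then have "ennreal (norm x powr (- p) * (?P x)\<^sup>2) * indicator (outer_region L) x \<le>
      ennreal (?N m powr (- p) * L powr (- p)) * (ennreal ((?P x)\<^sup>2) * indicator (cell L m) x)"
      using True m by (simp add: ennreal_mult'[symmetric] ennreal_leI)
    \<comment> \<open>The term of one cell containing \<open>x\<close> is bounded by the whole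
      nonnegative sum.\<close>
    also have "\<dots> \<le> (\<integral>\<^sup>+m. ennreal (?N m powr (- p) * L powr (- p)) *
        (ennreal ((?P x)\<^sup>2) * indicator (cell L m) x) \<partial>count_space ?Z)"
      using m(1) by (intro nn_integral_ge_point) simp
    finally show ?thesis .
  qed simp
  have "(\<integral>\<^sup>+x\<in>outer_region L. ennreal (norm x powr (- p) * (?P x)\<^sup>2) \<partial>lborel) \<le>
    (\<integral>\<^sup>+x. \<integral>\<^sup>+m. ennreal (?N m powr (- p) * L powr (- p)) *
      (ennreal ((?P x)\<^sup>2) * indicator (cell L m) x) \<partial>count_space ?Z \<partial>lborel)"
    by (intro nn_integral_mono pointwise)
  also have "\<dots> = (\<integral>\<^sup>+m. \<integral>\<^sup>+x. ennreal (?N m powr (- p) * L powr (- p)) *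
      (ennreal ((?P x)\<^sup>2) * indicator (cell L m) x) \<partial>lborel \<partial>count_space ?Z)"
    by (rule nn_integral_count_space_nn_integral[OF cnt]) measurable
  also have "\<dots> = (\<integral>\<^sup>+m. ennreal (?N m powr (- p) * L powr (- p)) *
      (\<integral>\<^sup>+x. ennreal ((?P x)\<^sup>2) * indicator (cell L m) x \<partial>lborel) \<partial>count_space ?Z)"
    by (intro nn_integral_cong nn_integral_cmult) measurable
  also have "\<dots> \<le> (\<integral>\<^sup>+m. ennreal (?N m powr (- p) * L powr (- p)) *
      ennreal ((2 * L) ^ CARD('d) * (\<Sum>k\<in>K. (a k)\<^sup>2)) \<partial>count_space ?Z)"
    by (intro nn_integral_mono mult_left_mono nn_integral_cos_polynomial_cell L K) simp
  also have "\<dots> = (\<integral>\<^sup>+m. ennreal (?N m powr (- p)) *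
      ennreal (L powr (- p) * ((2 * L) ^ CARD('d) * (\<Sum>k\<in>K. (a k)\<^sup>2))) \<partial>count_space ?Z)"
    using L by (intro nn_integral_cong) (simp add: ennreal_mult'[symmetric] mult.assoc)
  also have "\<dots> = (\<integral>\<^sup>+m. ennreal (?N m powr (- p)) \<partial>count_space ?Z) *
      ennreal (L powr (- p) * ((2 * L) ^ CARD('d) * (\<Sum>k\<in>K. (a k)\<^sup>2)))"
    by (rule nn_integral_multc) simp
  also have "\<dots> \<le> (\<Sum>\<^sub>\<infinity>m\<in>?Z. ennreal (?N m powr (- p))) *
      ennreal (L powr (- p) * ((2 * L) ^ CARD('d) * (\<Sum>k\<in>K. (a k)\<^sup>2)))"
    by (intro mult_right_mono nn_integral_count_space_le_infsum cnt) simp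
  finally show ?thesis .
qed

text \<open>Duality: with \<open>P = \<Sum>\<^sub>k a\<^sub>k cos_prod L k\<close>, where \<open>a\<^sub>k\<close> are the coefficients themselves,
  \<open>\<Sum>\<^sub>k a\<^sub>k\<^sup>2\<close> equals the integral of \<open>f P\<close>, to which Cauchy-Schwarz with weight \<open>|x| powr p\<close> applies.\<close>

lemma cos_coefficients_bessel:
  fixes f :: "real ^ 'd \<Rightarrow> real"
  assumes f: "integrable lebesgue f" and L: "L > 0" and p: "p > real CARD('d)" and K: "finite K"
    and W: "(\<integral>\<^sup>+x\<in>outer_region L. ennreal (norm x powr p * \<bar>f x\<bar>\<^sup>2) \<partial>lebesgue) < \<infinity>"
  defines "a \<equiv> \<lambda>k. LINT x:outer_region L|lebesgue. f x * cos_prod L k x"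
  shows "ennreal (\<Sum>k\<in>K. (a k)\<^sup>2) \<le> ennreal ((2 * L) ^ CARD('d)) *
    (\<Sum>\<^sub>\<infinity>m\<in>(UNIV - {0} :: (int ^ 'd) set). ennreal (norm (\<chi> i. real_of_int (m $ i)) powr (- p))) *
    ennreal (L powr (- p)) * (\<integral>\<^sup>+x\<in>outer_region L. ennreal (norm x powr p * \<bar>f x\<bar>\<^sup>2) \<partial>lebesgue)"
    (is "_ \<le> _ * ?S * _ * ?W")
proof -
  let ?P = "\<lambda>x. \<Sum>k\<in>K. a k * cos_prod L k x"
  let ?O = "outer_region L :: (real ^ 'd) set"
  define A where "A = (\<Sum>k\<in>K. (a k)\<^sup>2)"
  have A0: "A \<ge> 0" by (simp add: A_def sum_nonneg)
  have p0: "p > 0" using p by (rule le_less_trans[rotated]) simp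
  have lm: "g \<in> borel_measurable borel \<Longrightarrow> g \<in> borel_measurable lebesgue" for g :: "real ^ 'd \<Rightarrow> real"
    by (rule measurable_completion) simp
  have [measurable]: "cos_prod L k \<in> borel_measurable lebesgue" for k :: "nat ^ 'd"
    by (rule lm) measurable
  have [measurable]: "(\<lambda>x::real^'d. norm x powr q) \<in> borel_measurable lebesgue" for q
    by (rule lm) measurable
  have [measurable]: "?O \<in> sets lebesgue" by (rule sets_completionI_sets) simp
  have powr_half_sq: "(norm x powr (q / 2))\<^sup>2 = norm x powr q" for x :: "real ^ 'd" and q
    by (cases "x = 0") (simp_all add: powr_power)
  have fm [measurable]: "f \<in> borel_measurable lebesgue" using f by simp
  have int: "integrable lebesgue (\<lambda>x. indicator ?O x * (f x * cos_prod L k x))" for k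
  proof (rule Bochner_Integration.integrable_bound[OF f])
    show "AE x in lebesgue. norm (indicator ?O x * (f x * cos_prod L k x)) \<le> norm (f x)"
      using abs_cos_prod_le[of L k] by (auto simp: indicator_def abs_mult mult_left_le)
  qed measurable
  have exp: "indicator ?O x * (f x * ?P x) = (\<Sum>k\<in>K. a k * (indicator ?O x * (f x * cos_prod L k x)))" for x
    by (simp add: sum_distrib_left mult_ac)
  have intP: "integrable lebesgue (\<lambda>x. indicator ?O x * (f x * ?P x))"
    unfolding exp by (intro Bochner_Integration.integrable_sum integrable_mult_right int)
  have "A = (LINT x|lebesgue. indicator ?O x * (f x * ?P x))"
    unfolding exp A_def
    by (simp add: Bochner_Integration.integral_sum int a_def set_lebesgue_integral_def power2_eq_square)
  also have "\<dots> \<le> (LINT x|lebesgue. \<bar>indicator ?O x * (f x * ?P x)\<bar>)"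
    using intP by (intro integral_mono) auto
  finally have "ennreal A \<le> ennreal (LINT x|lebesgue. \<bar>indicator ?O x * (f x * ?P x)\<bar>)"
    by (rule ennreal_leI)
  also have "\<dots> = (\<integral>\<^sup>+x. ennreal \<bar>indicator ?O x * (f x * ?P x)\<bar> \<partial>lebesgue)"
    using intP by (intro nn_integral_eq_integral[symmetric]) auto
  also have "\<dots> = (\<integral>\<^sup>+x. (ennreal (norm x powr (p / 2) * \<bar>f x\<bar>) * indicator ?O x) *
      (ennreal (norm x powr (- p / 2) * \<bar>?P x\<bar>) * indicator ?O x) \<partial>lebesgue)"
  proof (intro nn_integral_cong)
    fix x :: "real ^ 'd"
    \<comment> \<open>The weight is split into reciprocal factors for Cauchy-Schwarz. At the origin
      both powers are 0 by convention and the identity fails, but the origin is outside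
      \<open>outer_region L\<close>.\<close>
    have "norm x powr (p / 2) * norm x powr (- p / 2) = 1" if "x \<noteq> 0"
      using that by (simp flip: powr_add)
    then have "(norm x powr (p / 2) * \<bar>f x\<bar>) * (norm x powr (- p / 2) * \<bar>?P x\<bar>) = \<bar>f x * ?P x\<bar>"
      if "x \<in> ?O"
      using nonzero_on_outer_region[OF L that] by (simp add: abs_mult mult_ac)
    then show "ennreal \<bar>indicator ?O x * (f x * ?P x)\<bar> =
      (ennreal (norm x powr (p / 2) * \<bar>f x\<bar>) * indicator ?O x) *
      (ennreal (norm x powr (- p / 2) * \<bar>?P x\<bar>) * indicator ?O x)"
      by (cases "x \<in> ?O") (simp_all add: ennreal_mult'[symmetric])
  qed
  finally have "(ennreal A)\<^sup>2 \<le> (\<integral>\<^sup>+x. (ennreal (norm x powr (p / 2) * \<bar>f x\<bar>) * indicator ?O x) *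
      (ennreal (norm x powr (- p / 2) * \<bar>?P x\<bar>) * indicator ?O x) \<partial>lebesgue)\<^sup>2"
    by (rule power_mono) simp
  also have "\<dots> \<le> (\<integral>\<^sup>+x. (ennreal (norm x powr (p / 2) * \<bar>f x\<bar>) * indicator ?O x)\<^sup>2 \<partial>lebesgue) *
      (\<integral>\<^sup>+x. (ennreal (norm x powr (- p / 2) * \<bar>?P x\<bar>) * indicator ?O x)\<^sup>2 \<partial>lebesgue)"
    by (rule Cauchy_Schwarz_nn_integral) measurable
  also have "(\<integral>\<^sup>+x. (ennreal (norm x powr (p / 2) * \<bar>f x\<bar>) * indicator ?O x)\<^sup>2 \<partial>lebesgue) = ?W"
    by (intro nn_integral_cong)
      (auto simp: indicator_def ennreal_power power_mult_distrib powr_half_sq)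
  \<comment> \<open>Nonnegative integrals agree for \<open>lborel\<close> and its completion; the
    orthogonality estimates were proved for the former.\<close>
  also have "(\<integral>\<^sup>+x. (ennreal (norm x powr (- p / 2) * \<bar>?P x\<bar>) * indicator ?O x)\<^sup>2 \<partial>lebesgue) =
      (\<integral>\<^sup>+x\<in>?O. ennreal (norm x powr (- p) * (?P x)\<^sup>2) \<partial>lborel)"
    unfolding nn_integral_completion
    by (intro nn_integral_cong)
      (auto simp: indicator_def ennreal_power power_mult_distrib powr_half_sq[of _ "- p", simplified])
  also have "?W * \<dots> \<le> ?W * (?S * ennreal (L powr (- p) * ((2 * L) ^ CARD('d) * A)))"
    unfolding A_def by (intro mult_left_mono nn_integral_cos_polynomial_outer L p0 K) simp
  finally have main: "(ennreal A)\<^sup>2 \<le> ?W * (?S * ennreal (L powr (- p) * ((2 * L) ^ CARD('d) * A)))" .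
  \<comment> \<open>Both factors are finite, so the inequality descends to the reals. There
    \<open>A\<close> occurs squared on the left and once on the right, and one factor cancels unless
    \<open>A = 0\<close>, when the claim is trivial.\<close>
  obtain w where w: "?W = ennreal w" "w \<ge> 0" using W by (cases ?W) auto
  obtain s where s: "?S = ennreal s" "s \<ge> 0" using lattice_sum_finite[OF p] by (cases ?S) auto
  have "A\<^sup>2 \<le> w * (s * (L powr (- p) * ((2 * L) ^ CARD('d) * A)))"
    using main w(2) s(2) L A0 unfolding w(1) s(1)
    by (simp add: ennreal_power ennreal_mult'[symmetric] ennreal_le_iff)
  then have "A * A \<le> ((2 * L) ^ CARD('d) * s * L powr (- p) * w) * A"
    by (simp add: power2_eq_square mult_ac)
  then have "A \<le> (2 * L) ^ CARD('d) * s * L powr (- p) * w"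
    using A0 w(2) s(2) L by (cases "A = 0") (auto simp: mult_le_cancel_right)
  then show ?thesis
    using w(2) s(2) L unfolding w(1) s(1) A_def[symmetric]
    by (simp add: ennreal_mult'[symmetric] ennreal_leI)
qed

section \<open>The quantitative bound and admissibility\<close>

text \<open>A sum in \<open>ennreal\<close> is the supremum of its finite subsums, so the finite
  Bessel estimate suffices. The normalisation \<open>1 / L ^ CARD('d)\<close> reduces
  \<open>(2 * L) ^ CARD('d)\<close> to \<open>2 ^ CARD('d)\<close>, which is at most the prefactor
  in \<open>cos_C\<close> because the dimension is at least 1 and \<open>p\<close> is
  positive.\<close>

lemma cos_B_le:
  fixes f :: "real ^ 'd \<Rightarrow> real"
  assumes f: "integrable lebesgue f" and L: "L > 0" and p: "p > real CARD('d)"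
    and W: "(\<integral>\<^sup>+x\<in>outer_region L. ennreal (norm x powr p * \<bar>f x\<bar>\<^sup>2) \<partial>lebesgue) < \<infinity>"
  shows "cos_B f L \<le> cos_C TYPE('d) p * ennreal (L powr (- p)) *
    (\<integral>\<^sup>+x\<in>outer_region L. ennreal (norm x powr p * \<bar>f x\<bar>\<^sup>2) \<partial>lebesgue)" (is "_ \<le> _ * _ * ?W")
proof -
  let ?S = "\<Sum>\<^sub>\<infinity>m\<in>(UNIV - {0} :: (int ^ 'd) set). ennreal (norm (\<chi> i. real_of_int (m $ i)) powr (- p))"
  let ?a = "\<lambda>k. LINT x:outer_region L|lebesgue. f x * cos_prod L k x"
  have d: "real CARD('d) \<ge> 1" by (simp add: Suc_leI)
  have "(2::real) ^ CARD('d) = 2 ^ (CARD('d) - 1) * (1 + 1)"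
    by (simp add: power_eq_if)
  also have "\<dots> \<le> 2 ^ (CARD('d) - 1) * (1 + real CARD('d) powr (p / 2))"
    using d p by (intro mult_left_mono add_left_mono ge_one_powr_ge_zero) auto
  finally have const: "(2::real) ^ CARD('d) \<le> 2 ^ (CARD('d) - 1) * (1 + real CARD('d) powr (p / 2))" .
  have "cos_B f L = (\<Sum>\<^sub>\<infinity>k\<in>UNIV. ennreal (1 / L ^ CARD('d) * (?a k)\<^sup>2))"
    by (simp add: cos_B_def cos_prod_def)
  also have "\<dots> \<le> cos_C TYPE('d) p * ennreal (L powr (- p)) * ?W"
    unfolding infsum_ennreal_eq_SUP
  proof (rule SUP_least, clarify)
    fix K :: "(nat ^ 'd) set" assume K: "finite K"
    have "(\<Sum>k\<in>K. ennreal (1 / L ^ CARD('d) * (?a k)\<^sup>2)) = ennreal (1 / L ^ CARD('d)) * ennreal (\<Sum>k\<in>K. (?a k)\<^sup>2)"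
      using L by (simp add: sum_ennreal ennreal_mult'[symmetric] sum_distrib_left sum_nonneg)
    also have "\<dots> \<le> ennreal (1 / L ^ CARD('d)) * (ennreal ((2 * L) ^ CARD('d)) * ?S * ennreal (L powr (- p)) * ?W)"
      by (intro mult_left_mono cos_coefficients_bessel f L p K W) simp
    also have "\<dots> = ennreal (1 / L ^ CARD('d) * (2 * L) ^ CARD('d)) * ?S * ennreal (L powr (- p)) * ?W"
    proof -
      have "ennreal (1 / L ^ CARD('d) * (2 * L) ^ CARD('d)) =
          ennreal (1 / L ^ CARD('d)) * ennreal ((2 * L) ^ CARD('d))"
        using L by (intro ennreal_mult) simp_all
      then show ?thesis by (simp only: mult.assoc)
    qed
    also have "1 / L ^ CARD('d) * (2 * L) ^ CARD('d) = 2 ^ CARD('d)"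
      using L by (simp add: power_mult_distrib)
    also have "ennreal (2 ^ CARD('d)) * ?S * ennreal (L powr (- p)) * ?W \<le> cos_C TYPE('d) p * ennreal (L powr (- p)) * ?W"
      unfolding cos_C_def by (intro mult_right_mono ennreal_leI const) simp_all
    finally show "(\<Sum>k\<in>K. ennreal (1 / L ^ CARD('d) * (?a k)\<^sup>2)) \<le> cos_C TYPE('d) p * ennreal (L powr (- p)) * ?W" .
  qed
  finally show ?thesis .
qed

theorem proposition2:
  fixes f :: "real ^ 'd \<Rightarrow> real" and p :: real
  assumes "L1_L2 f"
    and "p > real CARD('d)"
    and "(\<integral>\<^sup>+x. ennreal (norm x powr p * \<bar>f x\<bar>\<^sup>2) \<partial>lebesgue) < \<infinity>"
  shows "cos_admissible f
    \<and> cos_C TYPE('d) p < \<infinity>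
    \<and> (\<forall>L>0. cos_B f L \<le> cos_C TYPE('d) p * ennreal (L powr (- p)) *
         (\<integral>\<^sup>+x\<in>outer_region L. ennreal (norm x powr p * \<bar>f x\<bar>\<^sup>2) \<partial>lebesgue))"
proof -
  let ?W = "\<lambda>L. \<integral>\<^sup>+x\<in>outer_region L. ennreal (norm x powr p * \<bar>f x\<bar>\<^sup>2) \<partial>lebesgue"
  let ?T = "\<integral>\<^sup>+x. ennreal (norm x powr p * \<bar>f x\<bar>\<^sup>2) \<partial>lebesgue"
  have p0: "p > 0" using assms(2) by (rule le_less_trans[rotated]) simp
  have WT: "?W L \<le> ?T" for L by (intro nn_integral_mono) (auto simp: indicator_def)
  have C: "cos_C TYPE('d) p < \<infinity>"
    unfolding cos_C_def using lattice_sum_finite[OF assms(2)] by (simp add: ennreal_mult_less_top)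
  have bound: "cos_B f L \<le> cos_C TYPE('d) p * ennreal (L powr (- p)) * ?W L" if "L > 0" for L
    using assms that le_less_trans[OF WT assms(3)] by (intro cos_B_le) (auto simp: L1_L2_def)
  \<comment> \<open>Replacing the tail integral by the full one leaves a fixed constant times
    \<open>L powr (- p)\<close>. The constant must be finite, since multiplication by infinity is
    not continuous at 0.\<close>
  have "((\<lambda>L. cos_C TYPE('d) p * ?T * ennreal (L powr (- p))) \<longlongrightarrow> cos_C TYPE('d) p * ?T * ennreal 0) at_top"
  proof (rule ennreal_tendsto_cmult)
    show "cos_C TYPE('d) p * ?T < top" using C assms(3) by (simp add: ennreal_mult_less_top)
    show "((\<lambda>L. ennreal (L powr (- p))) \<longlongrightarrow> ennreal 0) at_top"
      using p0 by (intro tendsto_ennrealI tendsto_neg_powr filterlim_ident) auto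
  qed
  then have lim: "((\<lambda>L. cos_C TYPE('d) p * ?T * ennreal (L powr (- p))) \<longlongrightarrow> 0) at_top" by simp
  have "(cos_B f \<longlongrightarrow> 0) at_top"
  proof (rule tendsto_sandwich[OF _ _ tendsto_const lim])
    show "\<forall>\<^sub>F L in at_top. cos_B f L \<le> cos_C TYPE('d) p * ?T * ennreal (L powr (- p))"
      using eventually_gt_at_top[of 0]
    proof eventually_elim
      case (elim L)
      have "cos_B f L \<le> cos_C TYPE('d) p * ennreal (L powr (- p)) * ?W L" by (rule bound[OF elim])
      also have "\<dots> \<le> cos_C TYPE('d) p * ennreal (L powr (- p)) * ?T"
        by (intro mult_left_mono WT) simp
      finally show ?case by (simp add: mult_ac)
    qed
  qed simp
  with assms(1) C bound show ?thesis by (auto simp: cos_admissible_def)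
qed

end
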